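(* Let $G$ be a topological group with a chain of subgroups $G_1\le G_2\le\cdots$ such that $G=\bigcup_{k=1}^\infty G_k$, where each $G_k$ is a proper, open subgroup that is coarsely bounded in $G$. Then there exists a one-ended tree $T$ such that $G$ equipped with its canonical coarse structure is coarsely equivalent to the set of leaves of $T$ equipped with the subspace metric.
   Context: Canonical (left-)coarse structure of a topological group $G$: $E\subset G\times G$ is an entourage iff $\sup_{(g,h)\in E}d(g,h)<\infty$ for every continuous left-invariant pseudometric $d$ on $G$. A subset $A\subset G$ is coarsely bounded in $G$ if it has finite diameter in every continuous left-invariant pseudometric on $G$. A map between coarse spaces is a coarse equivalence if it is bornologous (images of entourages are entourages), expanding (preimages of entourages are entourages) and cobounded (there is an entourage $E$ of the target such that every point of the target is $E$-related to a point of the image). A metric space carries the coarse structure whose entourages are the sets of pairs on which the metric is bounded. A tree is one-ended if it contains a geodesic ray and any two geodesic rays in it share a common tail (trees need not be locally finite). A leaf is a vertex of valence one. The set of leaves carries the restriction of the graph metric of $T$ (edges of length $1$). *)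

theory Defs
  imports "HOL-Analysis.Analysis" "HOL-Algebra.Group"
begin

section \<open>Coarse spaces\<close>

locale coarse_space =
  fixes X :: "'a set" and \<E> :: "('a \<times> 'a) set set"
  assumes entourage_subset: "E \<in> \<E> \<Longrightarrow> E \<subseteq> X \<times> X"
    and Id_on_entourage: "Id_on X \<in> \<E>"
    and subset_entourage: "\<lbrakk>E \<in> \<E>; F \<subseteq> E\<rbrakk> \<Longrightarrow> F \<in> \<E>"
    and Un_entourage: "\<lbrakk>E \<in> \<E>; F \<in> \<E>\<rbrakk> \<Longrightarrow> E \<union> F \<in> \<E>"
    and converse_entourage: "E \<in> \<E> \<Longrightarrow> E\<inverse> \<in> \<E>"
    and relcomp_entourage: "\<lbrakk>E \<in> \<E>; F \<in> \<E>\<rbrakk> \<Longrightarrow> E O F \<in> \<E>"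

definition bornologous ::
  "('a \<times> 'a) set set \<Rightarrow> ('b \<times> 'b) set set \<Rightarrow> ('a \<Rightarrow> 'b) \<Rightarrow> bool" where
  "bornologous \<E> \<F> f \<longleftrightarrow> (\<forall>E\<in>\<E>. map_prod f f ` E \<in> \<F>)"

definition expanding ::
  "'a set \<Rightarrow> ('a \<times> 'a) set set \<Rightarrow> ('b \<times> 'b) set set \<Rightarrow> ('a \<Rightarrow> 'b) \<Rightarrow> bool" where
  "expanding X \<E> \<F> f \<longleftrightarrow> (\<forall>F\<in>\<F>. map_prod f f -` F \<inter> X \<times> X \<in> \<E>)"

definition cobounded ::
  "'a set \<Rightarrow> 'b set \<Rightarrow> ('b \<times> 'b) set set \<Rightarrow> ('a \<Rightarrow> 'b) \<Rightarrow> bool" where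
  "cobounded X Y \<F> f \<longleftrightarrow> (\<exists>F\<in>\<F>. \<forall>y\<in>Y. \<exists>x\<in>X. (y, f x) \<in> F)"

definition coarse_equivalence ::
  "'a set \<Rightarrow> ('a \<times> 'a) set set \<Rightarrow> 'b set \<Rightarrow> ('b \<times> 'b) set set \<Rightarrow> ('a \<Rightarrow> 'b) \<Rightarrow> bool" where
  "coarse_equivalence X \<E> Y \<F> f \<longleftrightarrow>
     f ` X \<subseteq> Y \<and> bornologous \<E> \<F> f \<and> expanding X \<E> \<F> f \<and> cobounded X Y \<F> f"

definition coarsely_equivalent ::
  "'a set \<Rightarrow> ('a \<times> 'a) set set \<Rightarrow> 'b set \<Rightarrow> ('b \<times> 'b) set set \<Rightarrow> bool" where
  "coarsely_equivalent X \<E> Y \<F> \<longleftrightarrow> (\<exists>f. coarse_equivalence X \<E> Y \<F> f)"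

definition metric_entourages :: "'a set \<Rightarrow> ('a \<Rightarrow> 'a \<Rightarrow> real) \<Rightarrow> ('a \<times> 'a) set set" where
  "metric_entourages M d = {E. E \<subseteq> M \<times> M \<and> bdd_above ((\<lambda>(x, y). d x y) ` E)}"


section \<open>Topological groups and their canonical coarse structure\<close>

locale topological_group = group G for G (structure) +
  fixes \<T> :: "'a topology"
  assumes topspace_eq_carrier: "topspace \<T> = carrier G"
    and continuous_mult: "continuous_map (prod_topology \<T> \<T>) \<T> (\<lambda>(g, h). g \<otimes> h)"
    and continuous_inv: "continuous_map \<T> \<T> (\<lambda>g. inv g)"

definition pseudometric_on :: "'a set \<Rightarrow> ('a \<Rightarrow> 'a \<Rightarrow> real) \<Rightarrow> bool" where
  "pseudometric_on X d \<longleftrightarrow>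
     (\<forall>x\<in>X. \<forall>y\<in>X. 0 \<le> d x y) \<and>
     (\<forall>x\<in>X. d x x = 0) \<and>
     (\<forall>x\<in>X. \<forall>y\<in>X. d x y = d y x) \<and>
     (\<forall>x\<in>X. \<forall>y\<in>X. \<forall>z\<in>X. d x z \<le> d x y + d y z)"

definition continuous_left_invariant_pseudometric ::
  "('a, 'b) monoid_scheme \<Rightarrow> 'a topology \<Rightarrow> ('a \<Rightarrow> 'a \<Rightarrow> real) \<Rightarrow> bool" where
  "continuous_left_invariant_pseudometric G \<T> d \<longleftrightarrow>
     pseudometric_on (carrier G) d \<and>
     (\<forall>k\<in>carrier G. \<forall>g\<in>carrier G. \<forall>h\<in>carrier G. d (k \<otimes>\<^bsub>G\<^esub> g) (k \<otimes>\<^bsub>G\<^esub> h) = d g h) \<and>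
     continuous_map (prod_topology \<T> \<T>) euclideanreal (\<lambda>(g, h). d g h)"

definition group_entourages ::
  "('a, 'b) monoid_scheme \<Rightarrow> 'a topology \<Rightarrow> ('a \<times> 'a) set set" where
  "group_entourages G \<T> =
     {E. E \<subseteq> carrier G \<times> carrier G \<and>
         (\<forall>d. continuous_left_invariant_pseudometric G \<T> d \<longrightarrow> bdd_above ((\<lambda>(g, h). d g h) ` E))}"

definition coarsely_bounded ::
  "('a, 'b) monoid_scheme \<Rightarrow> 'a topology \<Rightarrow> 'a set \<Rightarrow> bool" where
  "coarsely_bounded G \<T> A \<longleftrightarrow>
     A \<subseteq> carrier G \<and>
     (\<forall>d. continuous_left_invariant_pseudometric G \<T> d \<longrightarrow>
          bdd_above ((\<lambda>(g, h). d g h) ` (A \<times> A)))"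


section \<open>Trees\<close>

text \<open>
  A (possibly infinite) simple graph is given by its vertex set and its adjacency predicate, so
  that \<open>(adj ^^ n) u v\<close> says that there is a walk with \<open>n\<close> edges from \<open>u\<close> to \<open>v\<close>.  The trees of
  the digraph library are unsuitable: there a pair of opposite arcs already counts as a cycle.
\<close>

locale simple_graph =
  fixes V :: "'v set" and adj :: "'v \<Rightarrow> 'v \<Rightarrow> bool"
  assumes adj_verts: "adj u v \<Longrightarrow> u \<in> V \<and> v \<in> V"
    and adj_sym: "adj u v \<Longrightarrow> adj v u"
    and adj_irrefl: "\<not> adj u u"

definition graph_cycle :: "('v \<Rightarrow> 'v \<Rightarrow> bool) \<Rightarrow> 'v list \<Rightarrow> bool" where
  "graph_cycle adj p \<longleftrightarrow>
     3 \<le> length p \<and> distinct p \<and> successively adj p \<and> adj (last p) (hd p)"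

locale tree = simple_graph +
  assumes nonempty: "V \<noteq> {}"
    and connected: "\<lbrakk>u \<in> V; v \<in> V\<rbrakk> \<Longrightarrow> adj\<^sup>*\<^sup>* u v"
    and acyclic: "\<not> graph_cycle adj p"

text \<open>Meaningful only for vertices in the same connected component.\<close>

definition graph_dist :: "('v \<Rightarrow> 'v \<Rightarrow> bool) \<Rightarrow> 'v \<Rightarrow> 'v \<Rightarrow> nat" where
  "graph_dist adj u v = (LEAST n. (adj ^^ n) u v)"

definition geodesic_ray :: "'v set \<Rightarrow> ('v \<Rightarrow> 'v \<Rightarrow> bool) \<Rightarrow> (nat \<Rightarrow> 'v) \<Rightarrow> bool" where
  "geodesic_ray V adj r \<longleftrightarrow>
     range r \<subseteq> V \<and> (\<forall>i j. i \<le> j \<longrightarrow> graph_dist adj (r i) (r j) = j - i)"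

locale one_ended_tree = tree +
  assumes ex_ray: "\<exists>r. geodesic_ray V adj r"
    and common_tail: "\<lbrakk>geodesic_ray V adj r; geodesic_ray V adj s\<rbrakk>
      \<Longrightarrow> \<exists>m n. \<forall>i. r (m + i) = s (n + i)"

definition leaves :: "'v set \<Rightarrow> ('v \<Rightarrow> 'v \<Rightarrow> bool) \<Rightarrow> 'v set" where
  "leaves V adj = {v \<in> V. card {w. adj v w} = 1}"


section \<open>The structures above are coarse structures\<close>

lemma coarse_space_bdd_pseudometrics:
  assumes "\<And>d. d \<in> D \<Longrightarrow> pseudometric_on X d"
  shows "coarse_space X {E. E \<subseteq> X \<times> X \<and> (\<forall>d\<in>D. bdd_above ((\<lambda>(x, y). d x y) ` E))}"
    (is "coarse_space X ?\<E>")
proof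
  have tri: "d x z \<le> d x y + d y z" if "d \<in> D" "x \<in> X" "y \<in> X" "z \<in> X" for d x y z
    using assms[OF that(1)] that by (simp add: pseudometric_on_def)
  have sym: "d x y = d y x" if "d \<in> D" "x \<in> X" "y \<in> X" for d x y
    using assms[OF that(1)] that by (simp add: pseudometric_on_def)
  have refl: "d x x = 0" if "d \<in> D" "x \<in> X" for d x
    using assms[OF that(1)] that by (simp add: pseudometric_on_def)
  show "E \<subseteq> X \<times> X" if "E \<in> ?\<E>" for E
    using that by simp
  show "Id_on X \<in> ?\<E>"
    by (auto simp: bdd_above_def refl intro!: exI[of _ 0])
  show "F \<in> ?\<E>" if "E \<in> ?\<E>" "F \<subseteq> E" for E F
  proof -
    have "bdd_above ((\<lambda>(x, y). d x y) ` F)" if "d \<in> D" for d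
      using \<open>E \<in> ?\<E>\<close> that by (intro bdd_above_mono[OF _ image_mono[OF \<open>F \<subseteq> E\<close>]]) simp
    with that show ?thesis by auto
  qed
  show "E \<union> F \<in> ?\<E>" if "E \<in> ?\<E>" "F \<in> ?\<E>" for E F
    using that by (auto simp: image_Un)
  show "E\<inverse> \<in> ?\<E>" if "E \<in> ?\<E>" for E
  proof -
    have "(\<lambda>(x, y). d x y) ` (E\<inverse>) = (\<lambda>(x, y). d x y) ` E" if "d \<in> D" for d
    proof -
      have "(\<lambda>(x, y). d x y) ` (E\<inverse>) = (\<lambda>(x, y). d y x) ` E"
        by auto
      also have "\<dots> = (\<lambda>(x, y). d x y) ` E"
      proof (rule image_cong[OF HOL.refl])
        fix p assume "p \<in> E"
        then have "p \<in> X \<times> X" using \<open>E \<in> ?\<E>\<close> by blast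
        then show "(case p of (x, y) \<Rightarrow> d y x) = (case p of (x, y) \<Rightarrow> d x y)"
          by (auto intro: sym[OF that])
      qed
      finally show ?thesis .
    qed
    then show ?thesis using that by auto
  qed
  show "E O F \<in> ?\<E>" if E: "E \<in> ?\<E>" and F: "F \<in> ?\<E>" for E F
  proof -
    have "bdd_above ((\<lambda>(x, y). d x y) ` (E O F))" if d: "d \<in> D" for d
    proof -
      obtain A where A: "\<And>x y. (x, y) \<in> E \<Longrightarrow> d x y \<le> A"
        using E d by (fastforce simp: bdd_above_def)
      obtain B where B: "\<And>x y. (x, y) \<in> F \<Longrightarrow> d x y \<le> B"
        using F d by (fastforce simp: bdd_above_def)
      have "d x z \<le> A + B" if "(x, y) \<in> E" "(y, z) \<in> F" for x y z
      proof -
        have "x \<in> X" "y \<in> X" "z \<in> X" using that E F by auto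
        then show ?thesis using tri[OF d, of x y z] A[OF that(1)] B[OF that(2)] by linarith
      qed
      then show ?thesis by (auto simp: bdd_above_def intro!: exI[of _ "A + B"])
    qed
    then show ?thesis using E F by auto
  qed
qed

lemma coarse_space_group: "coarse_space (carrier G) (group_entourages G \<T>)"
  using coarse_space_bdd_pseudometrics
      [of "{d. continuous_left_invariant_pseudometric G \<T> d}" "carrier G"]
  by (simp add: group_entourages_def continuous_left_invariant_pseudometric_def)

lemma coarse_space_metric:
  assumes "Metric_space M d"
  shows "coarse_space M (metric_entourages M d)"
proof -
  interpret Metric_space M d by fact
  have "pseudometric_on M d"
    by (auto simp: pseudometric_on_def commute triangle)
  then show ?thesis
    using coarse_space_bdd_pseudometrics[of "{d}" M] by (simp add: metric_entourages_def)
qed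

lemma (in simple_graph) relpowp_adj_sym: "(adj ^^ n) u v \<Longrightarrow> (adj ^^ n) v u"
proof (induction n arbitrary: v)
  case (Suc n)
  then show ?case by (metis adj_sym relpowp_Suc_E relpowp_Suc_I2)
qed simp

lemma (in tree) Metric_space_graph_dist: "Metric_space V (\<lambda>u v. real (graph_dist adj u v))"
proof
  have walk: "(adj ^^ graph_dist adj u v) u v" if "u \<in> V" "v \<in> V" for u v
    unfolding graph_dist_def using connected[OF that] by (metis LeastI_ex rtranclp_power)
  have le: "graph_dist adj u v \<le> n" if "(adj ^^ n) u v" for u v n
    unfolding graph_dist_def by (rule Least_le) fact
  have sym: "(adj ^^ n) u v \<longleftrightarrow> (adj ^^ n) v u" for n u v
    using relpowp_adj_sym by blast
  show "real (graph_dist adj u v) = real (graph_dist adj v u)" for u v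
    by (simp add: graph_dist_def sym[of _ u v])
  show "real (graph_dist adj u v) = 0 \<longleftrightarrow> u = v" if "u \<in> V" "v \<in> V" for u v
    using walk[OF that] le[of 0 u v] by auto
  show "real (graph_dist adj u w) \<le> real (graph_dist adj u v) + real (graph_dist adj v w)"
    if "u \<in> V" "v \<in> V" "w \<in> V" for u v w
    using le[of "graph_dist adj u v + graph_dist adj v w" u w] walk that
    by (force simp: relpowp_add)
qed simp

end

theory Submission
  imports Defs "HOL-Algebra.Coset"
begin

text \<open>
  The vertices of the tree are the pairs \<open>(g H\<^sub>k, k)\<close>, and \<open>(g H\<^sub>k, k)\<close> is joined to its parent
  \<open>(g H\<^sub>k\<^sub>+\<^sub>1, k + 1)\<close>; keeping the index makes the levels well defined even if the chain is not
  strict.  A geodesic ray that once descends must descend forever, so rays ascend, and any two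
  vertices have a common ancestor; hence the tree is one-ended.  Its leaves are the cosets of \<open>H\<^sub>1\<close>,
  and the distance between those of \<open>g\<close> and \<open>h\<close> is \<open>2 n\<close> for the least \<open>n\<close> with
  \<open>g\<inverse> h \<in> H\<^sub>n\<^sub>+\<^sub>1\<close>.  This distance is a continuous left-invariant pseudometric on \<open>G\<close>, and its balls
  are translates of the coarsely bounded groups \<open>H\<^sub>k\<close>, so \<open>g \<mapsto> g H\<^sub>1\<close> is a coarse equivalence.
\<close>

section \<open>Trees given by a parent function\<close>

text \<open>There is no root: parents lead towards the end, and \<open>level\<close> increases along
  the way. Common ancestors give connectedness and make upward rays merge.\<close>

locale parent_tree =
  fixes V :: "'v set" and parent :: "'v \<Rightarrow> 'v" and level :: "'v \<Rightarrow> nat"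
  assumes V_nonempty: "V \<noteq> {}"
    and parent_in_V: "v \<in> V \<Longrightarrow> parent v \<in> V"
    and level_parent: "v \<in> V \<Longrightarrow> level (parent v) = Suc (level v)"
    and common_ancestor: "\<lbrakk>u \<in> V; v \<in> V\<rbrakk> \<Longrightarrow> \<exists>m n. (parent ^^ m) u = (parent ^^ n) v"
begin

definition padj :: "'v \<Rightarrow> 'v \<Rightarrow> bool" where
  "padj u v \<longleftrightarrow> u \<in> V \<and> v \<in> V \<and> (v = parent u \<or> u = parent v)"

lemma ancestor_in_V: "v \<in> V \<Longrightarrow> (parent ^^ n) v \<in> V"
  by (induction n) (auto intro: parent_in_V)

lemma level_ancestor: "v \<in> V \<Longrightarrow> level ((parent ^^ n) v) = level v + n"
  by (induction n) (auto simp: level_parent ancestor_in_V)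

lemma padj_parent: "v \<in> V \<Longrightarrow> padj v (parent v)"
  by (simp add: padj_def parent_in_V)

lemma padj_sym: "padj u v \<Longrightarrow> padj v u"
  by (auto simp: padj_def)

section \<open>Walks and common ancestors\<close>

lemma walk_to_ancestor: "v \<in> V \<Longrightarrow> (padj ^^ n) v ((parent ^^ n) v)"
proof (induction n)
  case (Suc n)
  then show ?case using relpowp_Suc_I padj_parent[OF ancestor_in_V, of v n] by force
qed simp

sublocale simple_graph V padj
proof
  show "\<not> padj u u" for u
    using level_parent[of u] unfolding padj_def by (metis n_not_Suc_n)
qed (auto simp: padj_def)

lemma walk_via_common_ancestor:
  assumes "u \<in> V" "v \<in> V" "(parent ^^ m) u = (parent ^^ n) v"
  shows "(padj ^^ (m + n)) u v"
  unfolding relpowp_add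
  using walk_to_ancestor[OF assms(1), of m] relpowp_adj_sym[OF walk_to_ancestor[OF assms(2), of n]]
  unfolding assms(3) by (rule relcomppI)

text \<open>Appending an upward edge to the walk raises \<open>i\<close> by one, a downward edge
  raises \<open>j\<close> by one. So no walk is shorter than the best route over a common
  ancestor.\<close>

lemma common_ancestor_of_walk:
  assumes "u \<in> V" "(padj ^^ n) u v"
  shows "v \<in> V \<and> (\<exists>i j. i + j \<le> n \<and> (parent ^^ i) u = (parent ^^ j) v)"
  using assms(2)
proof (induction n arbitrary: v)
  case 0
  then show ?case using assms(1) by auto
next
  case (Suc n)
  then obtain w where w: "(padj ^^ n) u w" "padj w v" by auto
  from Suc.IH[OF w(1)] obtain i j
    where ij: "i + j \<le> n" "(parent ^^ i) u = (parent ^^ j) w" by blast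
  have "v \<in> V" using w(2) by (simp add: padj_def)
  moreover have "\<exists>i j. i + j \<le> Suc n \<and> (parent ^^ i) u = (parent ^^ j) v"
  proof (cases "v = parent w")
    case True
    then have "(parent ^^ Suc i) u = (parent ^^ j) v" using ij(2) funpow_swap1[of parent j w] by simp
    then show ?thesis using ij(1) by (intro exI[of _ "Suc i"] exI[of _ j]) simp
  next
    case False
    then have "w = parent v" using w(2) by (simp add: padj_def)
    then have "(parent ^^ i) u = (parent ^^ Suc j) v" using ij(2) funpow_swap1[of parent j v] by simp
    then show ?thesis using ij(1) by (intro exI[of _ i] exI[of _ "Suc j"]) simp
  qed
  ultimately show ?case ..
qed

lemma graph_dist_le: "(padj ^^ n) u v \<Longrightarrow> graph_dist padj u v \<le> n"
  unfolding graph_dist_def by (rule Least_le)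

lemma padj_connected: "\<lbrakk>u \<in> V; v \<in> V\<rbrakk> \<Longrightarrow> padj\<^sup>*\<^sup>* u v"
  using common_ancestor walk_via_common_ancestor relpowp_imp_rtranclp by metis

lemma walk_graph_dist:
  assumes "u \<in> V" "v \<in> V"
  shows "(padj ^^ graph_dist padj u v) u v"
  unfolding graph_dist_def using padj_connected[OF assms] by (metis LeastI_ex rtranclp_power)

text \<open>Some common ancestor is at most \<open>graph_dist padj u v\<close> steps above
  \<open>u\<close>, and its level is at least that of \<open>v\<close>.\<close>

lemma level_le_graph_dist:
  assumes "u \<in> V" "v \<in> V"
  shows "level v \<le> level u + graph_dist padj u v"
proof -
  obtain i j where "i + j \<le> graph_dist padj u v" "(parent ^^ i) u = (parent ^^ j) v"
    using common_ancestor_of_walk[OF assms(1) walk_graph_dist[OF assms]] by blast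
  then show ?thesis
    using level_ancestor[OF assms(1), of i] level_ancestor[OF assms(2), of j] by simp
qed

text \<open>The two neighbours, on a cycle, of a vertex of least level would both be its parent.\<close>

lemma padj_acyclic: "\<not> graph_cycle padj p"
proof
  assume "graph_cycle padj p"
  then have len: "3 \<le> length p" and dist: "distinct p" and succ: "successively padj p"
    and last: "padj (last p) (hd p)"
    by (auto simp: graph_cycle_def)
  define n where "n = length p"
  have "n \<ge> 3" using len by (simp add: n_def)
  have next_adj: "padj (p ! i) (p ! (Suc i mod n))" if "i < n" for i
  proof (cases "Suc i < n")
    case True
    then show ?thesis using succ by (simp add: n_def successively_conv_nth)
  next
    case False
    then have "Suc i = n" using that by simp
    moreover have "p \<noteq> []" using len by auto
    then have "last p = p ! (n - 1)" "hd p = p ! 0"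
      by (simp_all add: last_conv_nth hd_conv_nth n_def)
    ultimately show ?thesis using last by auto
  qed
  obtain i where i: "i < n" "\<And>j. j < n \<Longrightarrow> level (p ! i) \<le> level (p ! j)"
    using ex_has_least_nat[of "\<lambda>i. i < n" 0 "\<lambda>i. level (p ! i)"] \<open>n \<ge> 3\<close> by auto
  have up: "p ! j = parent (p ! i)" if "j < n" "padj (p ! i) (p ! j)" for j
    using that i(2)[of j] level_parent[of "p ! j"] by (auto simp: padj_def)
  \<comment> \<open>The cyclic predecessor of \<open>i\<close>; since \<open>n \<ge> 3\<close>, it
    differs from the cyclic successor.\<close>
  define j where "j = (if i = 0 then n - 1 else i - 1)"
  have j: "j < n" "Suc j mod n = i" "j \<noteq> Suc i mod n"
    using i(1) \<open>n \<ge> 3\<close> by (auto simp: j_def mod_Suc)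
  have "p ! (Suc i mod n) = parent (p ! i)"
    using next_adj[OF i(1)] \<open>n \<ge> 3\<close> by (intro up) auto
  moreover have "p ! j = parent (p ! i)"
    using next_adj[OF j(1)] j by (intro up) (auto intro: padj_sym)
  moreover have "Suc i mod n < n" using \<open>n \<ge> 3\<close> by simp
  ultimately show False
    using dist j(1,3) by (metis n_def nth_eq_iff_index_eq)
qed

sublocale tree V padj
  using V_nonempty padj_connected padj_acyclic by unfold_locales auto

section \<open>Geodesic rays and one-endedness\<close>

lemma geodesic_ray_ascends:
  assumes "geodesic_ray V padj r"
  shows "r i = (parent ^^ i) (r 0)"
proof -
  have rV: "r i \<in> V" for i using assms by (auto simp: geodesic_ray_def)
  have dist: "graph_dist padj (r i) (r j) = j - i" if "i \<le> j" for i j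
    using assms that by (simp add: geodesic_ray_def)
  have step: "padj (r i) (r (Suc i))" for i
    using walk_graph_dist[OF rV rV, of i "Suc i"] dist[of i "Suc i"] by auto
  have no_backtrack: "r (Suc (Suc i)) \<noteq> r i" for i
    using dist[of i "Suc (Suc i)"] dist[of i i] by auto
  have up: "r (Suc i) = parent (r i)" for i
  proof (rule ccontr)
    assume "r (Suc i) \<noteq> parent (r i)"
    then have start: "r i = parent (r (Suc i))" using step[of i] by (auto simp: padj_def)
    \<comment> \<open>An upward step out of \<open>r (Suc (i + k))\<close> would lead back to its
      only parent \<open>r (i + k)\<close>, which \<open>no_backtrack\<close> excludes.\<close>
    have down: "r (i + k) = parent (r (Suc (i + k)))" for k
    proof (induction k)
      case (Suc k)
      then show ?case
        using step[of "Suc (i + k)"] no_backtrack[of "i + k"] by (auto simp: padj_def)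
    qed (simp add: start)
    have "level (r (i + k)) + k = level (r i)" for k
    proof (induction k)
      case (Suc k)
      then show ?case using down[of k] level_parent[OF rV, of "Suc (i + k)"] by simp
    qed simp
    \<comment> \<open>One descent more than the level of \<open>r i\<close> allows.\<close>
    from this[of "Suc (level (r i))"] show False by simp
  qed
  show ?thesis by (induction i) (simp_all add: up)
qed

text \<open>Climbing is a walk of \<open>j - i\<close> edges, and no walk is shorter because the
  levels of its ends differ by \<open>j - i\<close>.\<close>

lemma ancestors_geodesic_ray:
  assumes "v \<in> V"
  shows "geodesic_ray V padj (\<lambda>i. (parent ^^ i) v)"
  unfolding geodesic_ray_def
proof (intro conjI allI impI)
  show "range (\<lambda>i. (parent ^^ i) v) \<subseteq> V" using assms by (auto intro: ancestor_in_V)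
  fix i j :: nat assume "i \<le> j"
  then have "(parent ^^ (j - i)) ((parent ^^ i) v) = (parent ^^ j) v"
    by (simp flip: comp_apply[of "parent ^^ _"] funpow_add)
  then have "graph_dist padj ((parent ^^ i) v) ((parent ^^ j) v) \<le> j - i"
    using walk_to_ancestor[OF ancestor_in_V[OF assms], of "j - i" i] by (intro graph_dist_le) simp
  moreover have "j - i \<le> graph_dist padj ((parent ^^ i) v) ((parent ^^ j) v)"
    using level_le_graph_dist[OF ancestor_in_V ancestor_in_V, OF assms assms, of j i]
    by (simp add: level_ancestor assms)
  ultimately show "graph_dist padj ((parent ^^ i) v) ((parent ^^ j) v) = j - i" by simp
qed

text \<open>Both rays are sequences of iterated parents, so they agree from a common ancestor of
  their starting points onwards.\<close>

lemma one_ended: "one_ended_tree V padj"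
proof
  show "\<exists>r. geodesic_ray V padj r"
    using V_nonempty ancestors_geodesic_ray by blast
  fix r s assume rs: "geodesic_ray V padj r" "geodesic_ray V padj s"
  then have "r 0 \<in> V" "s 0 \<in> V" by (auto simp: geodesic_ray_def)
  then obtain m n where mn: "(parent ^^ m) (r 0) = (parent ^^ n) (s 0)"
    using common_ancestor by blast
  have "r (m + i) = s (n + i)" for i
  proof -
    have "r (m + i) = (parent ^^ i) ((parent ^^ m) (r 0))"
      by (subst geodesic_ray_ascends[OF rs(1)]) (simp add: add.commute[of m] funpow_add)
    also have "\<dots> = s (n + i)"
      by (subst geodesic_ray_ascends[OF rs(2)]) (simp add: add.commute[of n] funpow_add mn)
    finally show ?thesis .
  qed
  then show "\<exists>m n. \<forall>i. r (m + i) = s (n + i)" by blast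
qed

section \<open>Leaves and distances within a level\<close>

text \<open>Every vertex is adjacent to its parent, so it has valence one exactly when it has no
  child; a child is never the parent, as their levels differ by two.\<close>

lemma leaves_eq: "leaves V padj = V - parent ` V"
proof (intro equalityI subsetI)
  fix v assume "v \<in> leaves V padj"
  then have v: "v \<in> V" and card: "card {w. padj v w} = 1" by (auto simp: leaves_def)
  have "v \<noteq> parent w" if "w \<in> V" for w
  proof
    assume eq: "v = parent w"
    have "w \<noteq> parent v"
      using level_parent[OF v] level_parent[OF \<open>w \<in> V\<close>] eq by auto
    moreover have "w \<in> {w. padj v w}" "parent v \<in> {w. padj v w}"
      using that v eq padj_parent padj_sym by auto
    ultimately show False using card by (metis card_1_singletonE singletonD)
  qed
  then show "v \<in> V - parent ` V" using v by blast
next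
  fix v assume v: "v \<in> V - parent ` V"
  then have "{w. padj v w} = {parent v}" by (auto simp: padj_def parent_in_V)
  then show "v \<in> leaves V padj" using v by (simp add: leaves_def)
qed

text \<open>Equal levels force equally many steps up and down, so a shortest walk turns at the
  lowest common ancestor.\<close>

lemma graph_dist_same_level:
  assumes "u \<in> V" "v \<in> V" "level u = level v"
  shows "graph_dist padj u v = 2 * (LEAST n. (parent ^^ n) u = (parent ^^ n) v)"
    (is "_ = 2 * ?n")
proof (rule antisym)
  obtain i j where ij: "i + j \<le> graph_dist padj u v" "(parent ^^ i) u = (parent ^^ j) v"
    using common_ancestor_of_walk[OF assms(1) walk_graph_dist[OF assms(1,2)]] by blast
  then have "i = j"
    using level_ancestor[OF assms(1), of i] level_ancestor[OF assms(2), of j] assms(3) by simp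
  then have eq: "(parent ^^ i) u = (parent ^^ i) v" using ij(2) by simp
  have "?n \<le> i" using eq by (rule Least_le)
  then show "2 * ?n \<le> graph_dist padj u v" using ij(1) \<open>i = j\<close> by linarith
  have "(parent ^^ ?n) u = (parent ^^ ?n) v" using eq by (rule LeastI)
  from walk_via_common_ancestor[OF assms(1,2) this]
  show "graph_dist padj u v \<le> 2 * ?n" unfolding mult_2 by (rule graph_dist_le)
qed

end

section \<open>The coset tree of an exhausting chain of subgroups\<close>

context group
begin

lemma l_coset_eq_iff:
  assumes "subgroup K G" "g \<in> carrier G" "h \<in> carrier G"
  shows "g <# K = h <# K \<longleftrightarrow> inv g \<otimes> h \<in> K"
proof -
  have "h \<in> g <# K \<longleftrightarrow> inv g \<otimes> h \<in> K"
  proof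
    assume "h \<in> g <# K"
    then obtain k where "k \<in> K" "h = g \<otimes> k" by (auto simp: l_coset_def)
    then show "inv g \<otimes> h \<in> K"
      using assms by (simp add: subgroup.mem_carrier inv_solve_left m_assoc[symmetric])
  next
    assume "inv g \<otimes> h \<in> K"
    moreover have "h = g \<otimes> (inv g \<otimes> h)" using assms by (simp add: m_assoc[symmetric])
    ultimately show "h \<in> g <# K" unfolding l_coset_def by blast
  qed
  moreover have "h = h \<otimes> \<one>" "\<one> \<in> K"
    using assms subgroup.one_closed by auto
  then have "h \<in> h <# K" unfolding l_coset_def by blast
  ultimately show ?thesis
    using l_repr_independence[OF _ assms(2,1)] by metis
qed

end

locale subgroup_chain = group G for G (structure) +
  fixes H :: "nat \<Rightarrow> 'a set"
  assumes subgroup_H: "k \<ge> 1 \<Longrightarrow> subgroup (H k) G"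
    and H_Suc: "k \<ge> 1 \<Longrightarrow> H k \<subseteq> H (Suc k)"
    and carrier_eq_Union: "carrier G = (\<Union>k\<in>{1..}. H k)"
begin

lemma H_mono:
  assumes "1 \<le> k" "k \<le> l"
  shows "H k \<subseteq> H l"
  using assms(2,1)
proof (induction l rule: dec_induct)
  case (step n)
  then show ?case using H_Suc[of n] by auto
qed simp

definition coset_verts :: "('a set \<times> nat) set" where
  "coset_verts = {(g <# H k, k) | g k. g \<in> carrier G \<and> k \<ge> 1}"

text \<open>Multiplying by \<open>H (Suc k)\<close> avoids a choice of representative: for
  \<open>k \<ge> 1\<close> it enlarges \<open>g <# H k\<close> to \<open>g <# H (Suc k)\<close>,
  because \<open>H k \<subseteq> H (Suc k)\<close>.\<close>

definition coset_parent :: "'a set \<times> nat \<Rightarrow> 'a set \<times> nat" where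
  "coset_parent = (\<lambda>(C, k). (C <#> H (Suc k), Suc k))"

lemma coset_parent_l_coset:
  assumes "g \<in> carrier G" "k \<ge> 1"
  shows "coset_parent (g <# H k, k) = (g <# H (Suc k), Suc k)"
proof -
  have K: "subgroup (H k) G" "subgroup (H (Suc k)) G" using subgroup_H assms(2) by auto
  have "H k <#> H (Suc k) = H (Suc k)"
    using H_Suc[OF assms(2)] K unfolding set_mult_def
    by (auto intro: subgroup.m_closed subgroup.one_closed
        intro!: bexI[of _ "\<one>"] simp: subgroup.mem_carrier)
  then show ?thesis
    using assms K unfolding coset_parent_def
    by (simp add: l_coset_eq_set_mult set_mult_assoc subgroup.subset)
qed

lemma coset_ancestor:
  assumes "g \<in> carrier G" "k \<ge> 1"
  shows "(coset_parent ^^ n) (g <# H k, k) = (g <# H (k + n), k + n)"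
  by (induction n) (use assms in \<open>simp_all add: coset_parent_l_coset\<close>)

lemma mem_large_H:
  assumes "x \<in> carrier G"
  obtains k where "k \<ge> 1" "\<And>l. l \<ge> k \<Longrightarrow> x \<in> H l"
proof -
  from assms obtain k where "k \<ge> 1" "x \<in> H k" using carrier_eq_Union by auto
  then show thesis using that H_mono by blast
qed

sublocale coset_tree: parent_tree coset_verts coset_parent snd
proof
  show "coset_verts \<noteq> {}" unfolding coset_verts_def by blast
  show "coset_parent v \<in> coset_verts" "snd (coset_parent v) = Suc (snd v)"
    if v: "v \<in> coset_verts" for v
  proof -
    obtain g k where "v = (g <# H k, k)" "g \<in> carrier G" "k \<ge> 1"
      using v by (auto simp: coset_verts_def)
    then show "coset_parent v \<in> coset_verts" "snd (coset_parent v) = Suc (snd v)"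
      unfolding coset_verts_def by (auto simp: coset_parent_l_coset)
  qed
  fix u v assume "u \<in> coset_verts" "v \<in> coset_verts"
  then obtain g k h l
    where u: "u = (g <# H k, k)" "g \<in> carrier G" "k \<ge> 1"
      and v: "v = (h <# H l, l)" "h \<in> carrier G" "l \<ge> 1"
    by (auto simp: coset_verts_def)
  obtain n where n: "n \<ge> 1" "\<And>i. i \<ge> n \<Longrightarrow> inv g \<otimes> h \<in> H i"
    using mem_large_H[of "inv g \<otimes> h"] u v by auto
  \<comment> \<open>Both vertices are raised to the same level \<open>k + l + n\<close>, which is at
    least \<open>n\<close>, so \<open>H\<close> at that level contains
    \<open>inv g \<otimes> h\<close>.\<close>
  have "(coset_parent ^^ (l + n)) u = (coset_parent ^^ (k + n)) v"
    using u v n l_coset_eq_iff[OF subgroup_H, of "k + (l + n)" g h]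
    by (simp add: coset_ancestor add_ac)
  then show "\<exists>m n. (coset_parent ^^ m) u = (coset_parent ^^ n) v" by blast
qed

section \<open>Leaves of the coset tree and their distances\<close>

abbreviation coset_leaf :: "'a \<Rightarrow> 'a set \<times> nat" where
  "coset_leaf g \<equiv> (g <# H 1, 1)"

text \<open>The shift by one makes this the number of steps up from level 1; it is zero on
  \<open>H 1\<close>.\<close>

definition chain_length :: "'a \<Rightarrow> nat" where
  "chain_length x = (LEAST n. x \<in> H (Suc n))"

text \<open>Parents have level at least 2, and a vertex \<open>(g <# H (Suc l), Suc l)\<close> with
  \<open>l \<ge> 1\<close> is the parent of \<open>(g <# H l, l)\<close>.\<close>

lemma leaves_coset_tree: "leaves coset_verts coset_tree.padj = coset_leaf ` carrier G"
proof -
  have "coset_leaf g \<noteq> coset_parent v" if "v \<in> coset_verts" for g v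
    using that by (auto simp: coset_verts_def coset_parent_l_coset)
  moreover have "v \<in> coset_parent ` coset_verts"
    if "v \<in> coset_verts" "v \<notin> coset_leaf ` carrier G" for v
  proof -
    obtain g k where v: "v = (g <# H k, k)" "g \<in> carrier G" "k \<ge> 1"
      using \<open>v \<in> coset_verts\<close> by (auto simp: coset_verts_def)
    have "k \<noteq> 1"
    proof
      assume "k = 1"
      with v that(2) show False by blast
    qed
    then obtain l where l: "k = Suc l" "l \<ge> 1"
      using v(3) by (cases k) auto
    then have "v = coset_parent (g <# H l, l)"
      using v by (simp add: coset_parent_l_coset)
    moreover have "(g <# H l, l) \<in> coset_verts"
      using v(2) l(2) unfolding coset_verts_def by blast
    ultimately show ?thesis by blast
  qed
  moreover have "coset_leaf ` carrier G \<subseteq> coset_verts"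
    unfolding coset_verts_def by blast
  ultimately have "coset_verts - coset_parent ` coset_verts = coset_leaf ` carrier G"
    by (intro equalityI subsetI) (blast, auto)
  then show ?thesis by (simp only: coset_tree.leaves_eq)
qed

lemma graph_dist_coset_leaf:
  assumes "g \<in> carrier G" "h \<in> carrier G"
  shows "graph_dist coset_tree.padj (coset_leaf g) (coset_leaf h) = 2 * chain_length (inv g \<otimes> h)"
proof -
  have "coset_leaf g \<in> coset_verts" "coset_leaf h \<in> coset_verts"
    using assms unfolding coset_verts_def by blast+
  moreover have "(coset_parent ^^ n) (coset_leaf g) = (coset_parent ^^ n) (coset_leaf h)
      \<longleftrightarrow> inv g \<otimes> h \<in> H (Suc n)" for n
    using coset_ancestor[OF assms(1), of 1 n] coset_ancestor[OF assms(2), of 1 n]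
      l_coset_eq_iff[OF subgroup_H assms, of "Suc n"] by simp
  ultimately show ?thesis
    by (simp add: coset_tree.graph_dist_same_level chain_length_def)
qed

text \<open>By monotonicity of the chain, the sublevel sets of \<open>chain_length\<close> are the
  subgroups themselves.\<close>

lemma chain_length_le_iff:
  assumes "x \<in> carrier G"
  shows "chain_length x \<le> n \<longleftrightarrow> x \<in> H (Suc n)"
proof
  obtain k where "k \<ge> 1" "\<And>l. l \<ge> k \<Longrightarrow> x \<in> H l" using mem_large_H[OF assms] by blast
  then have "x \<in> H (Suc k)" by simp
  then have "x \<in> H (Suc (chain_length x))" unfolding chain_length_def by (rule LeastI)
  then show "x \<in> H (Suc n)" if "chain_length x \<le> n"
    using H_mono[of "Suc (chain_length x)" "Suc n"] that by auto
  show "chain_length x \<le> n" if "x \<in> H (Suc n)"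
    unfolding chain_length_def using that by (rule Least_le)
qed

text \<open>As \<open>y\<close> lies in every \<open>H (Suc n)\<close>, right multiplication by it
  preserves membership both ways. Hence \<open>chain_length\<close> is constant on left cosets of
  \<open>H 1\<close>, which will give continuity.\<close>

lemma chain_length_mult_H1:
  assumes "x \<in> carrier G" "y \<in> H 1"
  shows "chain_length (x \<otimes> y) = chain_length x"
proof -
  have y: "y \<in> carrier G" using assms(2) subgroup.mem_carrier[OF subgroup_H] by blast
  have "x \<otimes> y \<in> H (Suc n) \<longleftrightarrow> x \<in> H (Suc n)" for n
  proof -
    have S: "subgroup (H (Suc n)) G" and "y \<in> H (Suc n)"
      using subgroup_H H_mono[of 1 "Suc n"] assms(2) by auto
    then have "x \<in> H (Suc n)" if "x \<otimes> y \<in> H (Suc n)"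
      using subgroup.m_closed[OF S that subgroup.m_inv_closed[OF S \<open>y \<in> H (Suc n)\<close>]] assms(1) y
      by (simp add: m_assoc)
    then show ?thesis using \<open>y \<in> H (Suc n)\<close> subgroup.m_closed[OF S] by blast
  qed
  then show ?thesis by (simp add: chain_length_def)
qed

end

section \<open>The tree metric as a continuous pseudometric\<close>

locale open_subgroup_chain = topological_group G \<T> + subgroup_chain G H
  for G (structure) and \<T> and H +
  assumes open_H1: "openin \<T> (H 1)"
begin

lemma continuous_left_mult:
  assumes "g \<in> carrier G"
  shows "continuous_map \<T> \<T> (\<lambda>x. g \<otimes> x)"
proof -
  have "continuous_map \<T> (prod_topology \<T> \<T>) (\<lambda>x. (g, x))"
    using assms topspace_eq_carrier by (intro continuous_map_pairedI) auto
  from continuous_map_compose[OF this continuous_mult] show ?thesis by (simp add: o_def)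
qed

lemma continuous_left_diff:
  "continuous_map (prod_topology \<T> \<T>) \<T> (\<lambda>(g, h). inv g \<otimes> h)"
proof -
  have "continuous_map (prod_topology \<T> \<T>) (prod_topology \<T> \<T>) (\<lambda>p. (inv (fst p), snd p))"
    using continuous_map_compose[OF continuous_map_fst continuous_inv]
    by (intro continuous_map_pairedI continuous_map_snd) (simp add: o_def)
  from continuous_map_compose[OF this continuous_mult] show ?thesis
    by (simp add: o_def case_prod_unfold)
qed

text \<open>The function is locally constant, because the left cosets of the open subgroup
  \<open>H 1\<close> are open; so the preimage of any set is open.\<close>

lemma continuous_chain_length: "continuous_map \<T> euclideanreal (\<lambda>x. real (2 * chain_length x))"
  unfolding continuous_map_def
proof (intro conjI allI impI)
  fix U :: "real set"
  let ?W = "{x \<in> topspace \<T>. real (2 * chain_length x) \<in> U}"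
  show "openin \<T> ?W"
  proof (subst openin_subopen, intro ballI)
    fix w assume w: "w \<in> ?W"
    then have wG: "w \<in> carrier G" using topspace_eq_carrier by simp
    \<comment> \<open>This is the left coset of \<open>w\<close>, written as a preimage under
      translation by \<open>inv w\<close> so that its openness follows from continuity.\<close>
    let ?N = "{x \<in> topspace \<T>. inv w \<otimes> x \<in> H 1}"
    have "openin \<T> ?N"
      using openin_continuous_map_preimage[OF continuous_left_mult open_H1] wG by simp
    moreover have "w \<in> ?N"
      using w wG subgroup.one_closed[OF subgroup_H] by simp
    moreover have "?N \<subseteq> ?W"
    proof
      fix x assume x: "x \<in> ?N"
      then have "x \<in> carrier G" using topspace_eq_carrier by simp
      then have "x = w \<otimes> (inv w \<otimes> x)" using wG by (simp add: m_assoc[symmetric])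
      then have "chain_length x = chain_length w"
        using chain_length_mult_H1[OF wG] x by (metis (no_types, lifting) mem_Collect_eq)
      then show "x \<in> ?W" using w x by simp
    qed
    ultimately show "\<exists>T. openin \<T> T \<and> w \<in> T \<and> T \<subseteq> ?W" by blast
  qed
qed auto

text \<open>The tree metric pulled back to the group along \<open>coset_leaf\<close>; it vanishes on
  pairs in one left coset of \<open>H 1\<close>, hence is in general only a pseudometric.\<close>

definition leaf_dist :: "'a \<Rightarrow> 'a \<Rightarrow> real" where
  "leaf_dist g h = real (graph_dist coset_tree.padj (coset_leaf g) (coset_leaf h))"

lemma leaf_dist_eq:
  "\<lbrakk>g \<in> carrier G; h \<in> carrier G\<rbrakk> \<Longrightarrow> leaf_dist g h = real (2 * chain_length (inv g \<otimes> h))"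
  unfolding leaf_dist_def by (simp only: graph_dist_coset_leaf)

text \<open>The pseudometric laws come from the tree metric; invariance and continuity hold because
  the value is a continuous function of \<open>inv g \<otimes> h\<close>.\<close>

lemma continuous_left_invariant_leaf_dist:
  "continuous_left_invariant_pseudometric G \<T> leaf_dist"
  unfolding continuous_left_invariant_pseudometric_def
proof (intro conjI ballI)
  interpret M: Metric_space coset_verts "\<lambda>u v. real (graph_dist coset_tree.padj u v)"
    by (rule coset_tree.Metric_space_graph_dist)
  have V: "coset_leaf g \<in> coset_verts" if "g \<in> carrier G" for g
    using that unfolding coset_verts_def by blast
  show "pseudometric_on (carrier G) leaf_dist"
    unfolding pseudometric_on_def leaf_dist_def
    using V M.commute M.triangle M.mdist_zero by (auto simp del: of_nat_eq_0_iff)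
  show "leaf_dist (k \<otimes> g) (k \<otimes> h) = leaf_dist g h"
    if "k \<in> carrier G" "g \<in> carrier G" "h \<in> carrier G" for k g h
  proof -
    have "inv k \<otimes> (k \<otimes> h) = h" using that by (simp add: m_assoc[symmetric])
    then have "inv (k \<otimes> g) \<otimes> (k \<otimes> h) = inv g \<otimes> h"
      using that by (simp add: inv_mult_group m_assoc)
    then show ?thesis using that by (simp add: leaf_dist_eq)
  qed
  have "continuous_map (prod_topology \<T> \<T>) euclideanreal
      (\<lambda>(g, h). real (2 * chain_length (inv g \<otimes> h)))"
    using continuous_map_compose[OF continuous_left_diff continuous_chain_length]
    by (simp add: o_def case_prod_unfold)
  then show "continuous_map (prod_topology \<T> \<T>) euclideanreal (\<lambda>(g, h). leaf_dist g h)"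
    by (rule continuous_map_eq) (auto simp: topspace_eq_carrier leaf_dist_eq)
qed

section \<open>Coarse equivalence of the group with the leaves\<close>

text \<open>The map is bornologous because \<open>leaf_dist\<close> is among the pseudometrics that
  define the group entourages. It is expanding because a bound on the tree distance confines
  \<open>inv g \<otimes> h\<close> to a single coarsely bounded \<open>H k\<close>.\<close>

lemma coarse_equivalence_coset_leaf:
  assumes bounded: "\<And>k. k \<ge> 1 \<Longrightarrow> coarsely_bounded G \<T> (H k)"
  defines "L \<equiv> leaves coset_verts coset_tree.padj"
  shows "coarse_equivalence (carrier G) (group_entourages G \<T>) L
      (metric_entourages L (\<lambda>u v. real (graph_dist coset_tree.padj u v))) coset_leaf"
    (is "coarse_equivalence _ _ _ ?\<F> _")
proof -
  have L: "L = coset_leaf ` carrier G" by (simp add: L_def leaves_coset_tree)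
  have "bornologous (group_entourages G \<T>) ?\<F> coset_leaf"
    unfolding bornologous_def
  proof
    fix E assume E: "E \<in> group_entourages G \<T>"
    then have "E \<subseteq> carrier G \<times> carrier G" "bdd_above ((\<lambda>(g, h). leaf_dist g h) ` E)"
      using continuous_left_invariant_leaf_dist by (auto simp: group_entourages_def)
    then show "map_prod coset_leaf coset_leaf ` E \<in> ?\<F>"
      unfolding metric_entourages_def L
      by (auto simp: image_image leaf_dist_def case_prod_unfold)
  qed
  moreover have "expanding (carrier G) (group_entourages G \<T>) ?\<F> coset_leaf"
    unfolding expanding_def
  proof
    fix F assume "F \<in> ?\<F>"
    then obtain B where B: "\<And>u v. (u, v) \<in> F \<Longrightarrow> real (graph_dist coset_tree.padj u v) \<le> B"
      unfolding metric_entourages_def bdd_above_def by fastforce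
    let ?E = "map_prod coset_leaf coset_leaf -` F \<inter> carrier G \<times> carrier G"
    \<comment> \<open>A distance \<open>2 * chain_length\<close> of at most \<open>B\<close> bounds
      the chain length by \<open>nat \<lceil>B\<rceil>\<close>; the successor is the shift in
      \<open>chain_length_le_iff\<close>.\<close>
    define k where "k = Suc (nat \<lceil>B\<rceil>)"
    have mem: "inv g \<otimes> h \<in> H k" if "(g, h) \<in> ?E" for g h
    proof -
      have gh: "g \<in> carrier G" "h \<in> carrier G" "(coset_leaf g, coset_leaf h) \<in> F"
        using that by auto
      then have "real (2 * chain_length (inv g \<otimes> h)) \<le> B"
        using B[OF gh(3)] unfolding graph_dist_coset_leaf[OF gh(1,2)] by simp
      then have "chain_length (inv g \<otimes> h) \<le> nat \<lceil>B\<rceil>" by linarith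
      then show ?thesis using gh by (simp add: chain_length_le_iff k_def)
    qed
    have "bdd_above ((\<lambda>(g, h). d g h) ` ?E)"
      if d: "continuous_left_invariant_pseudometric G \<T> d" for d
    proof -
      have "bdd_above ((\<lambda>(g, h). d g h) ` (H k \<times> H k))"
        using bounded[of k] d by (simp add: coarsely_bounded_def k_def)
      then obtain C where C: "\<And>x y. x \<in> H k \<Longrightarrow> y \<in> H k \<Longrightarrow> d x y \<le> C"
        by (fastforce simp: bdd_above_def)
      have "d g h \<le> C" if gh: "(g, h) \<in> ?E" for g h
      proof -
        have c: "g \<in> carrier G" "h \<in> carrier G" using gh by auto
        \<comment> \<open>Left translation by \<open>inv g\<close> moves the pair to
          \<open>\<one>\<close> and \<open>inv g \<otimes> h\<close>, both in \<open>H k\<close>, so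
          one constant \<open>C\<close> serves all pairs.\<close>
        have "d g h = d (inv g \<otimes> g) (inv g \<otimes> h)"
          using d c inv_closed[OF c(1)]
          unfolding continuous_left_invariant_pseudometric_def by metis
        also have "\<dots> \<le> C"
          using C[of \<one> "inv g \<otimes> h"] mem[OF gh] subgroup.one_closed[OF subgroup_H, of k] c
          by (simp add: k_def)
        finally show ?thesis .
      qed
      then show ?thesis by (fastforce simp: bdd_above_def)
    qed
    then show "?E \<in> group_entourages G \<T>" by (simp add: group_entourages_def)
  qed
  moreover have "cobounded (carrier G) L ?\<F> coset_leaf"
    unfolding cobounded_def
  \<comment> \<open>The map is onto \<open>L\<close>, so the diagonal serves as the
    entourage.\<close>
  proof (rule bexI)
    have "Metric_space L (\<lambda>u v. real (graph_dist coset_tree.padj u v))"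
      by (rule Metric_space.subspace[OF coset_tree.Metric_space_graph_dist])
        (auto simp: L_def leaves_def)
    then show "Id_on L \<in> ?\<F>"
      using coarse_space.Id_on_entourage coarse_space_metric by blast
    show "\<forall>y\<in>L. \<exists>x\<in>carrier G. (y, coset_leaf x) \<in> Id_on L"
      unfolding L by blast
  qed
  ultimately show ?thesis by (simp add: coarse_equivalence_def L)
qed

end

theorem theoremC:
  fixes G :: "('a, 'b) monoid_scheme" and \<T> :: "'a topology" and H :: "nat \<Rightarrow> 'a set"
  assumes "topological_group G \<T>"
    and "\<And>k. k \<ge> 1 \<Longrightarrow> subgroup (H k) G"
    and "\<And>k. k \<ge> 1 \<Longrightarrow> H k \<subseteq> H (Suc k)"
    and "carrier G = (\<Union>k\<in>{1..}. H k)"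
    and "\<And>k. k \<ge> 1 \<Longrightarrow> H k \<noteq> carrier G"
    and "\<And>k. k \<ge> 1 \<Longrightarrow> openin \<T> (H k)"
    and "\<And>k. k \<ge> 1 \<Longrightarrow> coarsely_bounded G \<T> (H k)"
  shows "\<exists>(V :: ('a set \<times> nat) set) adj.
           one_ended_tree V adj \<and>
           coarsely_equivalent (carrier G) (group_entourages G \<T>)
             (leaves V adj)
             (metric_entourages (leaves V adj) (\<lambda>u v. real (graph_dist adj u v)))"
proof -
  interpret topological_group G \<T> by fact
  interpret open_subgroup_chain G \<T> H
  proof (intro open_subgroup_chain.intro subgroup_chain.intro subgroup_chain_axioms.intro
      open_subgroup_chain_axioms.intro)
    show "openin \<T> (H 1)" by (rule assms(6)) simp
  qed (fact topological_group_axioms is_group assms(2-4))+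
  have "coarsely_equivalent (carrier G) (group_entourages G \<T>)
      (leaves coset_verts coset_tree.padj)
      (metric_entourages (leaves coset_verts coset_tree.padj)
        (\<lambda>u v. real (graph_dist coset_tree.padj u v)))"
    unfolding coarsely_equivalent_def
    by (rule exI, rule coarse_equivalence_coset_leaf, rule assms(7))
  with coset_tree.one_ended show ?thesis by (intro exI conjI)
qed

end
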